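(* Let $\Pi$ be a SAT circular proof of a clause $A$ from a CNF formula $\mathcal F=\{C_1,\dots,C_p\}$ using the proof system consisting of symmetric resolution and split. Then there is a MaxSAT proof $$\{(C_1,\infty),\dots,(C_p,\infty),(\overline A,1)\}\vdash_{\mathbf{ResSV}}\{(\Box,1)\}$$ whose length is $O(|\Pi|)$.
   Context: SAT side. Clauses are disjunctions of literals; $\Box$ is the empty clause. SAT symmetric resolution derives $A$ from $x\lor A$ and $\overline x\lor A$; SAT split derives both $A\lor x$ and $A\lor\overline x$ from $A$. A circular pre-proof of a clause from $\mathcal F=\{C_1,\dots,C_p\}$ is a sequence $C_1,\dots,C_p,C_{p+1},\dots,C_{p+q},C_{p+q+1},\dots,C_r$ where $\mathcal B=\{C_{p+1},\dots,C_{p+q}\}$ is an arbitrary set of clauses and each later clause is obtained from earlier ones by an inference rule. Its graph $G(\Pi)=(J\cup I,E)$ is built as follows: first take the acyclic bipartite directed graph with one clause node per clause occurrence (starting from $\mathcal F\cup\mathcal B$) and one inference node per inference step, with arcs from the antecedent clause nodes to the inference node and from the inference node to its consequent clause nodes; then, for each clause in $\mathcal B$, merge all clause nodes carrying that clause into a single node (which may create cycles). A flow is a map $f:I\to\mathbb{R}_{>0}$; the balance of $C\in J$ is $b(C)=\sum_{R\in N^-(C)}f(R)-\sum_{R\in N^+(C)}f(R)$ where $N^-(C),N^+(C)$ are the in- and out-neighbours of $C$. A SAT circular proof of $A$ from $\mathcal F$ is a circular pre-proof whose graph admits a flow in which all clause nodes not in $\mathcal F$ have non-negative balance and a clause node $A\in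 J$ has strictly positive balance. $|\Pi|$ is the size of $G(\Pi)$ (number of nodes $|J|+|I|$). MaxSAT side. Weights are elements of $\mathbb{R}_{>0}\cup\{\infty\}$ with $\infty\pm w=\infty$; during $\mathbf{ResSV}$ proofs clauses may also carry finite negative weights. A MaxSAT formula is a finite collection of weighted clauses $(C,w)$, where $(C,u),(C,v)$ may be merged into $(C,u+v)$ and conversely, and weight-$0$ clauses disappear. For $A=l_1\lor\dots\lor l_k$, $(\overline A,1)$ denotes the unit clauses $(\overline{l_1},1),\dots,(\overline{l_k},1)$. $\mathcal G\subseteq\mathcal F$ means every $(C,w)\in\mathcal G$ has some $(C,w')\in\mathcal F$ with $w\le w'$. A proof is a sequence $\mathcal F_0;\dots;\mathcal F_e$ (length $e$), each obtained from the previous by one rule application replacing antecedents by consequents; $\mathcal F\vdash_{\mathbf{ResSV}}\mathcal G$ means such a proof with $\mathcal F_0=\mathcal F$, $\mathcal G\subseteq\mathcal F_e$, all clauses of $\mathcal F_e$ of positive weight. $\mathbf{ResSV}$ rules: Resolution: from $(x\lor A,v),(\overline x\lor B,w)$ with $v,w$ positive, with $m=\min\{v,w\}$, derive $(A\lor B,m),(x\lor A,v-m),(\overline x\lor B,w-m),(x\lor A\lor\overline B,m),(\overline x\lor B\lor\overline A,m)$, where for $D=l_1\lor\dots\lor l_p$ the expression $(E\lor\overline D,u)$ stands for $(E\lor\overline{l_1},u),(E\lor l_1\lor\overline{l_2},u),\dots,(E\lor l_1\lor\dots\lor l_{p-1}\lor\overline{l_p},u)$ (nothing if $D$ is empty),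 tautologies discarded. Split: from $(A,w)$ with $w$ positive derive $(A\lor x,w),(A\lor\overline x,w)$. Virtual: with no antecedents, introduce $(A,w),(A,-w)$ for any clause $A$ and finite $w$.
   Formalization: The length bound proved is c·|Π| + |A| with an absolute constant c, where |A| is the number of literals of A; with |Π| counted in nodes, a bound O(|Π|) fails, e.g. for one resolution step deriving a wide clause A. *)

theory Defs
  imports Complex_Main "HOL-Library.FSet" "HOL-Library.Multiset" "HOL-Library.Extended_Real"
begin

datatype 'v lit = Pos 'v | Neg 'v

fun compl :: "'v lit \<Rightarrow> 'v lit" where
  "compl (Pos x) = Neg x"
| "compl (Neg x) = Pos x"

type_synonym 'v clause = "'v lit fset"

definition tautology :: "'v clause \<Rightarrow> bool" where
  "tautology C \<longleftrightarrow> (\<exists>l. l |\<in>| C \<and> compl l |\<in>| C)"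


section \<open>Circular proofs\<close>

text \<open>Antecedents are given as (0-based) positions in the sequence of clause occurrences, so that
  an inference refers to occurrences and not merely to clauses.
  In \<open>SymRes x i j A\<close> position \<open>i\<close> carries \<open>x \<or> A\<close> and position \<open>j\<close> carries \<open>\<not>x \<or> A\<close>;
  in \<open>Split x i A\<close> position \<open>i\<close> carries \<open>A\<close>.\<close>

datatype 'v inference = SymRes 'v nat nat "'v clause" | Split 'v nat "'v clause"

fun antecedents :: "'v inference \<Rightarrow> nat set" where
  "antecedents (SymRes x i j A) = {i, j}"
| "antecedents (Split x i A) = {i}"

fun consequents :: "'v inference \<Rightarrow> 'v clause list" where
  "consequents (SymRes x i j A) = [A]"
| "consequents (Split x i A) = [finsert (Pos x) A, finsert (Neg x) A]"

fun correct_inference :: "'v clause list \<Rightarrow> 'v inference \<Rightarrow> bool" where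
  "correct_inference cs (SymRes x i j A) \<longleftrightarrow>
     i < length cs \<and> j < length cs \<and> cs ! i = finsert (Pos x) A \<and> cs ! j = finsert (Neg x) A"
| "correct_inference cs (Split x i A) \<longleftrightarrow> i < length cs \<and> cs ! i = A"

record 'v preproof =
  given :: "'v clause list"
  bases :: "'v clause list"
  inferences :: "'v inference list"

definition occurrences :: "'v preproof \<Rightarrow> 'v clause list" where
  "occurrences P = given P @ bases P @ concat (map consequents (inferences P))"

text \<open>The number of clause occurrences preceding the consequents of the \<open>s\<close>-th inference.\<close>

definition offset :: "'v preproof \<Rightarrow> nat \<Rightarrow> nat" where
  "offset P s = length (given P) + length (bases P)
     + length (concat (map consequents (take s (inferences P))))"

definition circular_preproof :: "'v clause list \<Rightarrow> 'v preproof \<Rightarrow> bool" where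
  "circular_preproof F P \<longleftrightarrow> given P = F \<and>
     (\<forall>s < length (inferences P).
        correct_inference (take (offset P s) (occurrences P)) (inferences P ! s))"

text \<open>All occurrences of a clause of \<open>bases\<close> are identified in one node \<open>Merged\<close>; any other
  occurrence is a node of its own.\<close>

datatype 'v clause_node = Occ nat | Merged "'v clause"

definition node_at :: "'v preproof \<Rightarrow> nat \<Rightarrow> 'v clause_node" where
  "node_at P k = (if occurrences P ! k \<in> set (bases P) then Merged (occurrences P ! k) else Occ k)"

fun node_clause :: "'v preproof \<Rightarrow> 'v clause_node \<Rightarrow> 'v clause" where
  "node_clause P (Occ k) = occurrences P ! k"
| "node_clause P (Merged C) = C"

definition clause_nodes :: "'v preproof \<Rightarrow> 'v clause_node set" where
  "clause_nodes P = node_at P ` {..<length (occurrences P)}"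

definition inference_nodes :: "'v preproof \<Rightarrow> nat set" where
  "inference_nodes P = {..<length (inferences P)}"

definition graph_arcs ::
  "'v preproof \<Rightarrow> (('v clause_node + nat) \<times> ('v clause_node + nat)) set" where
  "graph_arcs P =
     {(Inl (node_at P i), Inr s) |i s. s \<in> inference_nodes P \<and> i \<in> antecedents (inferences P ! s)} \<union>
     {(Inr s, Inl (node_at P k)) |s k. s \<in> inference_nodes P \<and>
        offset P s \<le> k \<and> k < offset P s + length (consequents (inferences P ! s))}"

definition graph_size :: "'v preproof \<Rightarrow> nat" where
  "graph_size P = card (clause_nodes P) + card (inference_nodes P)"

definition in_nbrs :: "'v preproof \<Rightarrow> 'v clause_node \<Rightarrow> nat set" where
  "in_nbrs P n = {s \<in> inference_nodes P. (Inr s, Inl n) \<in> graph_arcs P}"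

definition out_nbrs :: "'v preproof \<Rightarrow> 'v clause_node \<Rightarrow> nat set" where
  "out_nbrs P n = {s \<in> inference_nodes P. (Inl n, Inr s) \<in> graph_arcs P}"

definition balance :: "'v preproof \<Rightarrow> (nat \<Rightarrow> real) \<Rightarrow> 'v clause_node \<Rightarrow> real" where
  "balance P f n = (\<Sum>s\<in>in_nbrs P n. f s) - (\<Sum>s\<in>out_nbrs P n. f s)"

definition circular_proof :: "'v clause list \<Rightarrow> 'v preproof \<Rightarrow> 'v clause \<Rightarrow> bool" where
  "circular_proof F P A \<longleftrightarrow> circular_preproof F P \<and>
     (\<exists>f. (\<forall>s\<in>inference_nodes P. f s > 0) \<and>
          (\<forall>n\<in>clause_nodes P. node_clause P n \<notin> set F \<longrightarrow> balance P f n \<ge> 0) \<and>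
          (\<exists>n\<in>clause_nodes P. node_clause P n = A \<and> balance P f n > 0))"


section \<open>MaxSAT proofs\<close>

type_synonym 'v maxsat = "('v clause \<times> ereal) multiset"

text \<open>Weights may only be divided into parts of the same sign. Otherwise \<open>(C, w)\<close>, \<open>(C, -w)\<close> could
  be introduced next to an existing \<open>(C, u)\<close> without using the virtual rule.
  Note that \<open>\<infinity> - \<infinity> = \<infinity>\<close> holds in type \<open>ereal\<close>.\<close>

inductive regroup :: "'v maxsat \<Rightarrow> 'v maxsat \<Rightarrow> bool" where
  merge: "regroup (M + {#(C, u), (C, v)#}) (M + {#(C, u + v)#})"
| unmerge: "(0 < u \<and> 0 < v) \<or> (u < 0 \<and> v < 0) \<Longrightarrow>
    regroup (M + {#(C, u + v)#}) (M + {#(C, u), (C, v)#})"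
| vanish: "regroup (M + {#(C, 0)#}) M"

text \<open>The clauses \<open>E \<or> \<not>l\<^sub>1\<close>, \<open>E \<or> l\<^sub>1 \<or> \<not>l\<^sub>2\<close>, \<dots>,
  \<open>E \<or> l\<^sub>1 \<or> \<dots> \<or> l\<^bsub>p-1\<^esub> \<or> \<not>l\<^sub>p\<close>.\<close>

fun or_neg :: "'v clause \<Rightarrow> 'v lit list \<Rightarrow> 'v clause list" where
  "or_neg E [] = []"
| "or_neg E (l # ls) = finsert (compl l) E # or_neg (finsert l E) ls"

definition weighted :: "ereal \<Rightarrow> 'v clause list \<Rightarrow> 'v maxsat" where
  "weighted w Cs = mset (map (\<lambda>C. (C, w)) Cs)"

text \<open>\<open>ressv_rule M N\<close>: the antecedents \<open>M\<close> are replaced by the consequents \<open>N\<close>. The literals of a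
  clause are unordered, so the resolution rule may enumerate them in any order \<open>as\<close>, \<open>bs\<close>.\<close>

inductive ressv_rule :: "'v maxsat \<Rightarrow> 'v maxsat \<Rightarrow> bool" where
  resolution: "\<lbrakk>0 < v; 0 < w; m = min v w;
      distinct as; fset_of_list as = A; distinct bs; fset_of_list bs = B\<rbrakk> \<Longrightarrow>
    ressv_rule {#(finsert (Pos x) A, v), (finsert (Neg x) B, w)#}
      (filter_mset (\<lambda>(C, u). \<not> tautology C)
        ({#(A |\<union>| B, m), (finsert (Pos x) A, v - m), (finsert (Neg x) B, w - m)#}
          + weighted m (or_neg (finsert (Pos x) A) bs)
          + weighted m (or_neg (finsert (Neg x) B) as)))"
| split: "0 < w \<Longrightarrow> ressv_rule {#(A, w)#} {#(finsert (Pos x) A, w), (finsert (Neg x) A, w)#}"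
| virtual: "ressv_rule {#} {#(A, ereal w), (A, - ereal w)#}"

definition ressv_step :: "'v maxsat \<Rightarrow> 'v maxsat \<Rightarrow> bool" where
  "ressv_step M N \<longleftrightarrow> (\<exists>K ants cons. regroup\<^sup>*\<^sup>* M (K + ants) \<and> ressv_rule ants cons \<and>
     regroup\<^sup>*\<^sup>* (K + cons) N)"

definition contained :: "'v maxsat \<Rightarrow> 'v maxsat \<Rightarrow> bool" where
  "contained G M \<longleftrightarrow> (\<forall>(C, w) \<in># G. \<exists>w'. (C, w') \<in># M \<and> w \<le> w')"

definition ressv_proof :: "'v maxsat \<Rightarrow> 'v maxsat \<Rightarrow> 'v maxsat list \<Rightarrow> bool" where
  "ressv_proof M G Ms \<longleftrightarrow> Ms \<noteq> [] \<and> hd Ms = M \<and>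
     (\<forall>i. Suc i < length Ms \<longrightarrow> ressv_step (Ms ! i) (Ms ! Suc i)) \<and>
     contained G (last Ms) \<and> (\<forall>(C, w) \<in># last Ms. 0 < w)"

definition proof_length :: "'v maxsat list \<Rightarrow> nat" where
  "proof_length Ms = length Ms - 1"

definition neg_units :: "'v clause \<Rightarrow> 'v maxsat" where
  "neg_units A = image_mset (\<lambda>l. ({|compl l|}, 1)) (mset_set (fset A))"

end

theory Submission
  imports Defs
begin

text \<open>Scale the flow so that the node carrying \<open>A\<close> has balance 1. An inference of flow value
  \<open>w\<close> is simulated by introducing its antecedents virtually with weights \<open>w\<close> and \<open>-w\<close> and applying
  the rule to the positive copies. After all inferences, the finite weight accumulated by a clause is
  the sum of the balances of the nodes carrying it, so that only clauses of \<open>F\<close> can have a negative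
  weight, and that one is absorbed by the weight \<open>\<infinity>\<close>. Hence a copy \<open>(A, 1)\<close> can be taken away (it is
  introduced virtually at the very beginning) and resolved with the negated units.

  Resolution discards tautologies, and the arcs of the graph are not counted with multiplicity. Both
  only matter for inferences involving a tautology, and such an inference changes the total weight of
  no other clause, so it is skipped.\<close>

section \<open>Regrouping and steps\<close>

lemma regroup_add: "regroup M N \<Longrightarrow> regroup (K + M) (K + N)"
proof (induction rule: regroup.induct)
  case (merge M C u v)
  show ?case using regroup.merge[of "K + M" C u v] by (simp add: add.assoc)
next
  case (unmerge u v M C)
  then show ?case using regroup.unmerge[of u v "K + M" C] by (simp add: add.assoc)
next
  case (vanish M C)
  show ?case using regroup.vanish[of "K + M" C] by (simp add: add.assoc)
qed

lemma regroups_add: "regroup\<^sup>*\<^sup>* M N \<Longrightarrow> regroup\<^sup>*\<^sup>* (K + M) (K + N)"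
  by (induction rule: rtranclp_induct) (auto intro: rtranclp.rtrancl_into_rtrancl regroup_add)

text \<open>Resolving premises of equal weight leaves remainders of weight 0. They have to go,
  because the last formula of a proof admits only positive weights.\<close>

lemma regroups_drop_zeros: "regroup\<^sup>*\<^sup>* M (filter_mset (\<lambda>(C, w). w \<noteq> 0) M)"
proof (induction M)
  case (add p M)
  have IH: "regroup\<^sup>*\<^sup>* (add_mset p M) (add_mset p (filter_mset (\<lambda>(C, w). w \<noteq> 0) M))"
    using regroups_add[OF add, of "{#p#}"] by simp
  show ?case
  proof (cases "snd p = 0")
    case True
    then obtain C where p: "p = (C, 0)" by (cases p) auto
    show ?thesis
      using IH regroup.vanish[of "filter_mset (\<lambda>(C, w). w \<noteq> 0) M" C]
      by (auto simp: p intro: rtranclp.rtrancl_into_rtrancl)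
  next
    case False
    then show ?thesis using IH by (cases p) auto
  qed
qed simp

lemma ressv_step_add:
  assumes "ressv_step M N"
  shows "ressv_step (K + M) (K + N)"
proof -
  obtain L ants cons where *: "regroup\<^sup>*\<^sup>* M (L + ants)" "ressv_rule ants cons"
    "regroup\<^sup>*\<^sup>* (L + cons) N"
    using assms unfolding ressv_step_def by blast
  have "regroup\<^sup>*\<^sup>* (K + M) ((K + L) + ants)" "regroup\<^sup>*\<^sup>* ((K + L) + cons) (K + N)"
    using regroups_add[OF *(1), of K] regroups_add[OF *(3), of K] by (simp_all add: add.assoc)
  then show ?thesis
    using *(2) unfolding ressv_step_def by blast
qed

lemma ressv_steps_add: "(ressv_step ^^ k) M N \<Longrightarrow> (ressv_step ^^ k) (K + M) (K + N)"
  by (induction k arbitrary: N) (auto intro: ressv_step_add)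

lemma ressv_step_regroup: "ressv_step M N \<Longrightarrow> regroup\<^sup>*\<^sup>* N N' \<Longrightarrow> ressv_step M N'"
  unfolding ressv_step_def by (meson rtranclp_trans)

text \<open>Regrouping costs no step, but it has to be attached to a rule application. Hence at
  least one step is required, to whose end the regrouping is appended.\<close>

lemma ressv_steps_regroup: "(ressv_step ^^ Suc k) M N \<Longrightarrow> regroup\<^sup>*\<^sup>* N N' \<Longrightarrow> (ressv_step ^^ Suc k) M N'"
  by (auto intro: ressv_step_regroup)

lemma ressv_rule_step: "ressv_rule M N \<Longrightarrow> ressv_step M N"
  unfolding ressv_step_def
  by (rule exI[of _ "{#}"], rule exI[of _ M], rule exI[of _ N]) simp

lemma ressv_step_drop_zeros:
  "ressv_rule M N \<Longrightarrow> ressv_step M (filter_mset (\<lambda>(C, w). w \<noteq> 0) N)"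
  by (rule ressv_step_regroup[OF ressv_rule_step regroups_drop_zeros])

lemma ressv_steps_trans:
  "(ressv_step ^^ k) L M \<Longrightarrow> (ressv_step ^^ l) M N \<Longrightarrow> (ressv_step ^^ (k + l)) L N"
  by (auto simp: relpowp_add)

lemma ressv_steps_proof:
  assumes "(ressv_step ^^ k) M N" "contained G N" "\<forall>(C, w) \<in># N. 0 < w"
  shows "\<exists>Ms. ressv_proof M G Ms \<and> proof_length Ms = k"
proof -
  obtain g where g: "g 0 = M" "g k = N" "\<forall>i<k. ressv_step (g i) (g (Suc i))"
    using assms(1) unfolding relpowp_fun_conv by blast
  have "hd (map g [0..<Suc k]) = M" "last (map g [0..<Suc k]) = N"
    using g(1,2) by (auto simp: hd_map hd_append)
  then have "ressv_proof M G (map g [0..<Suc k])"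
    unfolding ressv_proof_def using g(3) assms(2,3) by (auto simp del: upt_Suc)
  then show ?thesis
    by (intro exI[of _ "map g [0..<Suc k]"]) (simp add: proof_length_def)
qed

section \<open>Finite weights\<close>

text \<open>The bookkeeping of finite weights is done over \<open>real\<close>, where opposite
  weights cancel and sums can be rearranged freely; only the result is embedded into
  \<open>ereal\<close>.\<close>

definition finite_weights :: "('v clause \<times> real) multiset \<Rightarrow> 'v maxsat" where
  "finite_weights D = image_mset (\<lambda>(C, r). (C, ereal r)) D"

definition total_weight :: "('v clause \<times> real) multiset \<Rightarrow> 'v clause \<Rightarrow> real" where
  "total_weight D C = (\<Sum>(B, r)\<in>#D. if B = C then r else 0)"

lemma finite_weights_simps [simp]:
  "finite_weights {#} = {#}"
  "finite_weights (add_mset (C, r) D) = add_mset (C, ereal r) (finite_weights D)"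
  "finite_weights (D + E) = finite_weights D + finite_weights E"
  by (simp_all add: finite_weights_def)

lemma total_weight_simps [simp]:
  "total_weight {#} C = 0"
  "total_weight (add_mset (B, r) D) C = (if B = C then r else 0) + total_weight D C"
  "total_weight (D + E) C = total_weight D C + total_weight E C"
  by (simp_all add: total_weight_def)

lemma total_weight_sum:
  "finite S \<Longrightarrow> total_weight (\<Sum>s\<in>S. D s) C = (\<Sum>s\<in>S. total_weight (D s) C)"
  by (induction S rule: finite_induct) auto

text \<open>\<open>merge\<close> accepts weights of any sign, so all copies of a clause collapse
  into one that carries their sum. This is where virtual debts are paid off.\<close>

lemma regroups_total:
  "regroup\<^sup>*\<^sup>* (finite_weights D)
     (image_mset (\<lambda>C. (C, ereal (total_weight D C))) (mset_set (fst ` set_mset D)))"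
proof (induction D)
  case (add p D)
  obtain C r where p: "p = (C, r)" by (cases p)
  let ?S = "fst ` set_mset D"
  let ?N = "\<lambda>D S. image_mset (\<lambda>C. (C, ereal (total_weight D C))) (mset_set S)"
  let ?R = "?N D (?S - {C})"
  have IH: "regroup\<^sup>*\<^sup>* (finite_weights (add_mset p D)) ({#(C, ereal r)#} + ?N D ?S)"
    using regroups_add[OF add, of "{#(C, ereal r)#}"] by (simp add: p)
  have R: "?N (add_mset p D) (?S - {C}) = ?R"
    by (rule image_mset_cong) (auto simp: p)
  have new: "?N (add_mset p D) (insert C ?S) = ?R + {#(C, ereal (r + total_weight D C))#}"
    using R by (simp add: mset_set.insert_remove p)
  \<comment> \<open>A clause not yet present has total 0, so adding its first copy needs no
    merging.\<close>
  have tot0: "total_weight D C = 0" if "C \<notin> ?S"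
    using that unfolding total_weight_def by (force intro!: sum_mset.neutral)
  show ?case
  proof (cases "C \<in> ?S")
    case True
    then have "mset_set ?S = add_mset C (mset_set (?S - {C}))"
      by (simp add: mset_set.remove)
    then have "{#(C, ereal r)#} + ?N D ?S
      = ?R + {#(C, ereal r), (C, ereal (total_weight D C))#}"
      by simp
    moreover have "regroup (?R + {#(C, ereal r), (C, ereal (total_weight D C))#})
        (?N (add_mset p D) (insert C ?S))"
      unfolding new using regroup.merge[of ?R C "ereal r" "ereal (total_weight D C)"] by simp
    ultimately have "regroup ({#(C, ereal r)#} + ?N D ?S) (?N (add_mset p D) (insert C ?S))"
      by (simp only:)
    then have "regroup\<^sup>*\<^sup>* (finite_weights (add_mset p D)) (?N (add_mset p D) (insert C ?S))"
      by (rule rtranclp.rtrancl_into_rtrancl[OF IH])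
    then show ?thesis by (simp add: p)
  next
    case False
    then have "?S - {C} = ?S" by auto
    then show ?thesis using IH new p tot0[OF False] by simp
  qed
qed simp

text \<open>Three things can happen to a collected weight: a clause of \<open>F\<close> absorbs it
  since \<infinity> plus a finite number is \<infinity>, a zero vanishes, and a positive weight
  stays in \<open>N\<close>.\<close>

lemma regroups_absorb:
  assumes "finite S" "\<forall>C\<in>S. C \<in> set F \<or> 0 \<le> t C"
  shows "\<exists>N. regroup\<^sup>*\<^sup>* (weighted \<infinity> F + image_mset (\<lambda>C. (C, ereal (t C))) (mset_set S))
    (weighted \<infinity> F + N) \<and> (\<forall>(C, w)\<in>#N. 0 < w)"
  using assms
proof (induction S rule: finite_induct)
  case empty
  then show ?case by (intro exI[of _ "{#}"]) simp
next
  case (insert C S)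
  let ?W = "weighted \<infinity> F"
  let ?N = "\<lambda>S. image_mset (\<lambda>C. (C, ereal (t C))) (mset_set S)"
  obtain N where N: "regroup\<^sup>*\<^sup>* (?W + ?N S) (?W + N)" "\<forall>(C, w)\<in>#N. 0 < w"
    using insert by auto
  have 1: "regroup\<^sup>*\<^sup>* (?W + ?N (insert C S)) ({#(C, ereal (t C))#} + (?W + N))"
    using regroups_add[OF N(1), of "{#(C, ereal (t C))#}"] insert by simp
  consider "C \<in> set F" | "t C = 0" | "0 < t C"
    using insert.prems by fastforce
  then show ?case
  proof cases
    case 1
    then have "(C, \<infinity>) \<in># ?W" by (auto simp: weighted_def)
    then obtain W' where W': "?W = add_mset (C, \<infinity>) W'"
      by (meson multi_member_split)
    have "regroup ({#(C, ereal (t C))#} + (?W + N)) (?W + N)"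
      using regroup.merge[of "W' + N" C "ereal (t C)" \<infinity>] by (simp add: W' add_mset_commute)
    then show ?thesis
      using \<open>regroup\<^sup>*\<^sup>* (?W + ?N (insert C S)) _\<close> N(2)
      by (blast intro: rtranclp.rtrancl_into_rtrancl)
  next
    case 2
    then have "regroup ({#(C, ereal (t C))#} + (?W + N)) (?W + N)"
      using regroup.vanish[of "?W + N" C] by (simp add: zero_ereal_def)
    then show ?thesis
      using \<open>regroup\<^sup>*\<^sup>* (?W + ?N (insert C S)) _\<close> N(2)
      by (blast intro: rtranclp.rtrancl_into_rtrancl)
  next
    case 3
    then show ?thesis
      using \<open>regroup\<^sup>*\<^sup>* (?W + ?N (insert C S)) _\<close> N(2)
      by (intro exI[of _ "add_mset (C, ereal (t C)) N"]) auto
  qed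
qed

lemma regroups_positive:
  assumes "\<forall>C. C \<in> set F \<or> 0 \<le> total_weight D C"
  obtains N where "regroup\<^sup>*\<^sup>* (weighted \<infinity> F + finite_weights D) (weighted \<infinity> F + N)"
    "\<forall>(C, w)\<in>#N. 0 < w"
proof -
  obtain N where "regroup\<^sup>*\<^sup>* (weighted \<infinity> F + image_mset (\<lambda>C. (C, ereal (total_weight D C)))
      (mset_set (fst ` set_mset D))) (weighted \<infinity> F + N)" "\<forall>(C, w)\<in>#N. 0 < w"
    using regroups_absorb[of "fst ` set_mset D" F "total_weight D"] assms by auto
  then show ?thesis
    using that regroups_add[OF regroups_total[of D], of "weighted \<infinity> F"]
    by (meson rtranclp_trans)
qed

section \<open>Resolution with negated units\<close>

lemma compl_compl [simp]: "compl (compl l) = l"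
  by (cases l) auto

lemma compl_neq [simp]: "compl l \<noteq> l"
  by (cases l) auto

lemma tautology_mono: "tautology A \<Longrightarrow> A |\<subseteq>| B \<Longrightarrow> tautology B"
  by (auto simp: tautology_def)

lemma tautology_finsert:
  "tautology (finsert l A) \<longleftrightarrow> tautology A \<or> compl l |\<in>| A"
  unfolding tautology_def by (metis compl_compl compl_neq finsert_iff)

lemma distinct_fset_of_list:
  obtains xs where "distinct xs" "fset_of_list xs = A"
  by (metis finite_distinct_list finite_fset fset_inject fset_of_list.rep_eq)

text \<open>Both premises have weight 1, so they are used up and leave only zero remainders. Since
  \<open>A\<close> is not a tautology, the resolvent survives the filter; the compensation clauses
  that survive have weight 1 and form \<open>N\<close>.\<close>

lemma resolve_unit:
  assumes "\<not> tautology A" "l |\<in>| A"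
  obtains N where "ressv_step {#(A, 1), ({|compl l|}, 1)#} (add_mset (A |-| {|l|}, 1) N)"
    "\<forall>(C, w)\<in>#N. 0 < w"
proof -
  let ?A = "A |-| {|l|}"
  have A: "finsert l ?A = A" using assms(2) by auto
  have taut: "\<not> tautology ?A" using assms(1) tautology_mono[of ?A A] by auto
  obtain as where as: "distinct as" "fset_of_list as = ?A" by (rule distinct_fset_of_list)
  have "\<exists>N. ressv_rule {#(A, 1), ({|compl l|}, 1)#} N \<and> (?A, 1) \<in># N \<and> (\<forall>(C, w)\<in>#N. 0 \<le> w)"
  proof (cases l)
    case (Pos x)
    \<comment> \<open>The side clause of the unit is empty and is enumerated by \<open>[]\<close>.
      The sign of \<open>l\<close> decides which of the two premises of the rule is the
      unit.\<close>
    have "ressv_rule {#(finsert (Pos x) ?A, 1), (finsert (Neg x) {||}, 1)#}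
      (filter_mset (\<lambda>(C, u). \<not> tautology C)
        ({#(?A |\<union>| {||}, 1), (finsert (Pos x) ?A, 1 - 1), (finsert (Neg x) {||}, 1 - 1)#}
          + weighted 1 (or_neg (finsert (Pos x) ?A) [])
          + weighted 1 (or_neg (finsert (Neg x) {||}) as)))" (is "ressv_rule ?M ?N")
      by (rule resolution) (auto simp: as)
    moreover have "?M = {#(A, 1), ({|compl l|}, 1)#}" using A Pos by simp
    moreover have "(?A, 1) \<in># ?N" using taut by simp
    moreover have "\<forall>(C, w)\<in>#?N. 0 \<le> w" by (auto simp: weighted_def)
    ultimately show ?thesis by metis
  next
    case (Neg x)
    have "ressv_rule {#(finsert (Pos x) {||}, 1), (finsert (Neg x) ?A, 1)#}
      (filter_mset (\<lambda>(C, u). \<not> tautology C)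
        ({#({||} |\<union>| ?A, 1), (finsert (Pos x) {||}, 1 - 1), (finsert (Neg x) ?A, 1 - 1)#}
          + weighted 1 (or_neg (finsert (Pos x) {||}) as)
          + weighted 1 (or_neg (finsert (Neg x) ?A) [])))" (is "ressv_rule ?M ?N")
      by (rule resolution) (auto simp: as)
    moreover have "?M = {#(A, 1), ({|compl l|}, 1)#}" using A Neg by simp
    moreover have "(?A, 1) \<in># ?N" using taut by simp
    moreover have "\<forall>(C, w)\<in>#?N. 0 \<le> w" by (auto simp: weighted_def)
    ultimately show ?thesis by metis
  qed
  then obtain N where N: "ressv_rule {#(A, 1), ({|compl l|}, 1)#} N" "(?A, 1) \<in># N"
    "\<forall>(C, w)\<in>#N. 0 \<le> w" by blast
  let ?N = "filter_mset (\<lambda>(C, w). w \<noteq> 0) N"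
  have "(?A, 1) \<in># ?N" using N(2) by simp
  then obtain N' where N': "?N = add_mset (?A, 1) N'" by (meson multi_member_split)
  have "\<forall>(C, w)\<in>#?N. 0 < w" using N(3) by fastforce
  then show ?thesis
    using that ressv_step_drop_zeros[OF N(1)] by (simp add: N')
qed

lemma neg_units_remove:
  assumes "l |\<in>| A"
  shows "neg_units A = add_mset ({|compl l|}, 1) (neg_units (A |-| {|l|}))"
proof -
  have "mset_set (fset A) = add_mset l (mset_set (fset A - {l}))"
    using assms by (simp add: mset_set.remove)
  then show ?thesis by (simp add: neg_units_def)
qed

text \<open>Each step removes one literal of \<open>A\<close> by means of its negated unit, while
  the by-products pile up in \<open>N\<close>.\<close>

lemma resolve_neg_units:
  assumes "\<not> tautology A"
  shows "\<exists>N. (ressv_step ^^ fcard A) (add_mset (A, 1) (neg_units A)) (add_mset ({||}, 1) N)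
    \<and> (\<forall>(C, w)\<in>#N. 0 < w)"
  using assms
proof (induction "fcard A" arbitrary: A)
  case 0
  then have "A = {||}" by simp
  then show ?case by (intro exI[of _ "{#}"]) (simp add: neg_units_def fcard.rep_eq)
next
  case (Suc k)
  then have "A \<noteq> {||}" by (auto simp: fcard.rep_eq)
  then obtain l where l: "l |\<in>| A" by blast
  let ?A = "A |-| {|l|}"
  have k: "k = fcard ?A" using Suc(2) l by simp
  have taut: "\<not> tautology ?A" using Suc(3) tautology_mono[of ?A A] by auto
  obtain N where N: "(ressv_step ^^ k) (add_mset (?A, 1) (neg_units ?A)) (add_mset ({||}, 1) N)"
    "\<forall>(C, w)\<in>#N. 0 < w" using Suc(1)[OF k taut] k by auto
  obtain N' where N': "ressv_step {#(A, 1), ({|compl l|}, 1)#} (add_mset (?A, 1) N')"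
    "\<forall>(C, w)\<in>#N'. 0 < w" using resolve_unit[OF Suc(3) l] .
  have "ressv_step (add_mset (A, 1) (neg_units A)) (N' + add_mset (?A, 1) (neg_units ?A))"
    using ressv_step_add[OF N'(1), of "neg_units ?A"] neg_units_remove[OF l]
    by (simp add: add_ac add_mset_commute)
  moreover have "(ressv_step ^^ k) (N' + add_mset (?A, 1) (neg_units ?A)) (N' + add_mset ({||}, 1) N)"
    using ressv_steps_add[OF N(1)] .
  ultimately have "(ressv_step ^^ Suc k) (add_mset (A, 1) (neg_units A)) (add_mset ({||}, 1) (N' + N))"
    by (metis relpowp_Suc_I2 union_mset_add_mset_right)
  then show ?case
    using Suc(2) N(2) N'(2) by (intro exI[of _ "N' + N"]) auto
qed

text \<open>The negated units of a tautology already contain two complementary unit clauses, so one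
  resolution refutes them without any use of the circular proof.\<close>

lemma resolve_neg_units_tautology:
  assumes "tautology A"
  shows "\<exists>N. ressv_step (neg_units A) (add_mset ({||}, 1) N) \<and> (\<forall>(C, w)\<in>#N. 0 < w)"
proof -
  obtain l where l: "l |\<in>| A" "compl l |\<in>| A" using assms by (auto simp: tautology_def)
  have "\<not> tautology {|l|}" by (auto simp: tautology_def)
  then obtain N where N: "ressv_step {#({|l|}, 1), ({|compl l|}, 1)#} (add_mset ({||}, 1) N)"
    "\<forall>(C, w)\<in>#N. 0 < w" using resolve_unit[of "{|l|}" l] by auto
  let ?A = "A |-| {|l|} |-| {|compl l|}"
  have "neg_units A = neg_units ?A + {#({|l|}, 1), ({|compl l|}, 1)#}"
    using l neg_units_remove[of l A] neg_units_remove[of "compl l" "A |-| {|l|}"] by auto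
  then have "ressv_step (neg_units A) (add_mset ({||}, 1) (neg_units ?A + N))"
    using ressv_step_add[OF N(1), of "neg_units ?A"] by simp
  moreover have "\<forall>(C, w)\<in>#neg_units ?A + N. 0 < w"
    using N(2) by (auto simp: neg_units_def)
  ultimately show ?thesis by blast
qed

section \<open>Simulation of inferences\<close>

text \<open>The antecedents are rebuilt from the side clause instead of being looked up by position,
  so the simulation is independent of the sequence.\<close>

fun antecedent_clauses :: "'v inference \<Rightarrow> 'v clause set" where
  "antecedent_clauses (SymRes x i j A) = {finsert (Pos x) A, finsert (Neg x) A}"
| "antecedent_clauses (Split x i A) = {A}"

text \<open>The net effect of simulating an inference with flow \<open>w\<close>: the entries
  \<open>- w\<close> are the virtual debts left once the rule has consumed the positive copies. The
  empty case is a skipped inference.\<close>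

fun weight_change :: "real \<Rightarrow> 'v inference \<Rightarrow> ('v clause \<times> real) multiset" where
  "weight_change w (SymRes x i j A) =
     (if tautology (finsert (Pos x) A) \<or> tautology (finsert (Neg x) A) then {#}
      else {#(finsert (Pos x) A, - w), (finsert (Neg x) A, - w), (A, w)#})"
| "weight_change w (Split x i A) =
     (if tautology (finsert (Pos x) A) \<or> tautology (finsert (Neg x) A) then {#}
      else {#(A, - w), (finsert (Pos x) A, w), (finsert (Neg x) A, w)#})"

lemma neq_finsert:
  assumes "\<not> tautology (finsert (Pos x) A)" "\<not> tautology (finsert (Neg x) A)"
  shows "finsert (Pos x) A \<noteq> A" "finsert (Neg x) A \<noteq> A" "finsert (Pos x) A \<noteq> finsert (Neg x) A"
  using assms by (auto simp: tautology_finsert)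

lemma finsert_Pos_eq_Neg:
  "finsert (Pos x) A = finsert (Neg x) A \<longleftrightarrow> Pos x |\<in>| A \<and> Neg x |\<in>| A"
  "finsert (Neg x) A = finsert (Pos x) A \<longleftrightarrow> Pos x |\<in>| A \<and> Neg x |\<in>| A"
  by auto

text \<open>If one of the two longer clauses is a tautology, then either \<open>A\<close> is one
  too, or one longer clause equals \<open>A\<close> and the other is a tautology. A clause
  \<open>C\<close> that is no tautology then occurs on both sides or on neither, so skipping the
  inference is harmless.\<close>

lemma total_weight_change:
  assumes "\<not> tautology C"
  shows "total_weight (weight_change w r) C =
    w * (of_bool (C \<in> set (consequents r)) - of_bool (C \<in> antecedent_clauses r))"
proof (cases r)
  case (SymRes x i j A)
  show ?thesis
  proof (cases "tautology (finsert (Pos x) A) \<or> tautology (finsert (Neg x) A)")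
    case True
    then have "C = A \<longleftrightarrow> C = finsert (Pos x) A \<or> C = finsert (Neg x) A"
      using assms by (auto simp: tautology_finsert finsert_absorb)
    then show ?thesis using True by (auto simp: SymRes)
  next
    case False
    then show ?thesis using neq_finsert[of x A] by (auto simp: SymRes)
  qed
next
  case (Split x i A)
  show ?thesis
  proof (cases "tautology (finsert (Pos x) A) \<or> tautology (finsert (Neg x) A)")
    case True
    then have "C = A \<longleftrightarrow> C = finsert (Pos x) A \<or> C = finsert (Neg x) A"
      using assms by (auto simp: tautology_finsert finsert_absorb)
    then show ?thesis using True by (auto simp: Split)
  next
    case False
    then show ?thesis using neq_finsert[of x A] by (auto simp: Split)
  qed
qed

text \<open>The total of a tautology need not agree with the balances of its nodes; that it is zero
  suffices to keep it from being negative.\<close>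

lemma total_weight_change_tautology:
  "tautology C \<Longrightarrow> total_weight (weight_change w r) C = 0"
  by (cases r) (auto simp: tautology_finsert)

text \<open>Every clause produced contains \<open>compl l\<close> for some \<open>l\<close> in
  \<open>ls\<close>, together with \<open>l\<close> itself from \<open>E\<close>.\<close>

lemma or_neg_tautology: "fset_of_list ls |\<subseteq>| E \<Longrightarrow> D \<in> set (or_neg E ls) \<Longrightarrow> tautology D"
proof (induction ls arbitrary: E)
  case (Cons l ls)
  then show ?case
    by (auto simp: tautology_finsert intro: Cons.IH[of "finsert l E"])
qed simp

text \<open>With equal side clauses all compensation clauses are tautologies, and with equal weights
  the remainders are zero, so only the resolvent is left.\<close>

lemma symmetric_resolution_step:
  assumes "0 < w" "\<not> tautology A"
  shows "ressv_step {#(finsert (Pos x) A, ereal w), (finsert (Neg x) A, ereal w)#} {#(A, ereal w)#}"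
proof -
  obtain as where as: "distinct as" "fset_of_list as = A" by (rule distinct_fset_of_list)
  have "ressv_rule {#(finsert (Pos x) A, ereal w), (finsert (Neg x) A, ereal w)#}
      (filter_mset (\<lambda>(C, u). \<not> tautology C)
        ({#(A |\<union>| A, ereal w), (finsert (Pos x) A, ereal w - ereal w), (finsert (Neg x) A, ereal w - ereal w)#}
          + weighted (ereal w) (or_neg (finsert (Pos x) A) as)
          + weighted (ereal w) (or_neg (finsert (Neg x) A) as)))" (is "ressv_rule _ ?N")
    by (rule resolution) (auto simp: as assms)
  moreover have empty: "filter_mset (\<lambda>(C, u). \<not> tautology C)
      (weighted (ereal w) (or_neg (finsert l A) as)) = {#}" for l
    using or_neg_tautology[of as "finsert l A"] as
    by (auto simp: weighted_def filter_mset_eq_conv)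
  have "filter_mset (\<lambda>(C, u). u \<noteq> 0) ?N = {#(A, ereal w)#}"
    unfolding filter_union_mset empty using assms by (simp add: zero_ereal_def)
  ultimately show ?thesis using ressv_step_drop_zeros by metis
qed

lemma virtual_step: "ressv_step M (M + {#(A, ereal w), (A, ereal (- w))#})"
  using ressv_step_add[OF ressv_rule_step[OF virtual[of A w]], of M] by simp

text \<open>Resolution takes two virtual introductions and one rule application, split takes one of
  each, and a skipped inference takes no step.\<close>

lemma simulate_inference:
  assumes "0 < w"
  shows "\<exists>k\<le>3. (ressv_step ^^ k) {#} (finite_weights (weight_change w r))"
proof (cases r)
  case (SymRes x i j A)
  let ?P = "finsert (Pos x) A" and ?N = "finsert (Neg x) A"
  show ?thesis
  proof (cases "tautology ?P \<or> tautology ?N")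
    case True
    then show ?thesis by (intro exI[of _ 0]) (auto simp: SymRes)
  next
    case False
    then have "\<not> tautology A" by (auto simp: tautology_finsert)
    let ?K = "{#(?P, ereal (- w)), (?N, ereal (- w))#}"
    let ?V = "{#(?P, ereal w), (?P, ereal (- w))#}"
    have "ressv_step {#} ?V" using virtual_step[of "{#}" ?P w] by simp
    moreover have "ressv_step ?V (?K + {#(?P, ereal w), (?N, ereal w)#})"
      using virtual_step[of ?V ?N w] by (simp add: add_mset_commute)
    moreover have "ressv_step (?K + {#(?P, ereal w), (?N, ereal w)#}) (?K + {#(A, ereal w)#})"
      by (rule ressv_step_add) (rule symmetric_resolution_step[OF assms \<open>\<not> tautology A\<close>])
    ultimately have "(ressv_step ^^ 3) {#} (?K + {#(A, ereal w)#})"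
      by (auto simp: numeral_3_eq_3)
    then show ?thesis
      using False by (intro exI[of _ 3]) (auto simp: SymRes add_mset_commute)
  qed
next
  case (Split x i A)
  let ?P = "finsert (Pos x) A" and ?N = "finsert (Neg x) A"
  show ?thesis
  proof (cases "tautology ?P \<or> tautology ?N")
    case True
    then show ?thesis by (intro exI[of _ 0]) (auto simp: Split)
  next
    case False
    let ?K = "{#(A, ereal (- w))#}"
    have "ressv_step {#} (?K + {#(A, ereal w)#})"
      using virtual_step[of "{#}" A w] by (simp add: add_mset_commute)
    moreover have "ressv_step (?K + {#(A, ereal w)#}) (?K + {#(?P, ereal w), (?N, ereal w)#})"
      by (rule ressv_step_add, rule ressv_rule_step, rule split) (simp add: assms)
    ultimately have "(ressv_step ^^ 2) {#} (?K + {#(?P, ereal w), (?N, ereal w)#})"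
      by (auto simp: numeral_2_eq_2)
    then show ?thesis
      using False by (intro exI[of _ 2]) (auto simp: Split add_mset_commute)
  qed
qed

text \<open>Each inference is simulated from the empty formula, next to whatever is present. No
  inference waits for its antecedents, so the cycles of the graph do not matter.\<close>

lemma simulate_inferences:
  assumes "\<forall>s<n. 0 < f s"
  shows "\<exists>k\<le>3 * n. (ressv_step ^^ k) M (M + finite_weights (\<Sum>s<n. weight_change (f s) (rs ! s)))"
  using assms
proof (induction n)
  case (Suc n)
  let ?D = "\<lambda>n. finite_weights (\<Sum>s<n. weight_change (f s) (rs ! s))"
  let ?E = "finite_weights (weight_change (f n) (rs ! n))"
  obtain k where k: "k \<le> 3 * n" "(ressv_step ^^ k) M (M + ?D n)"
    using Suc by auto
  obtain l where l: "l \<le> 3" "(ressv_step ^^ l) {#} ?E"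
    using simulate_inference Suc.prems by blast
  have "(ressv_step ^^ l) (M + ?D n) (M + ?D (Suc n))"
    using ressv_steps_add[OF l(2), of "M + ?D n"] by (simp add: add_ac)
  then have "(ressv_step ^^ (k + l)) M (M + ?D (Suc n))"
    using k(2) ressv_steps_trans by blast
  then show ?case using k(1) l(1) by (intro exI[of _ "k + l"]) auto
qed simp

section \<open>Balances of clauses\<close>

lemma nth_occurrences:
  assumes "s < length (inferences P)" "j < length (consequents (inferences P ! s))"
  shows "offset P s + j < length (occurrences P)"
    and "occurrences P ! (offset P s + j) = consequents (inferences P ! s) ! j"
proof -
  let ?L = "given P @ bases P @ concat (map consequents (take s (inferences P)))"
  have "inferences P = take s (inferences P) @ inferences P ! s # drop (Suc s) (inferences P)"
    using assms(1) by (rule id_take_nth_drop)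
  then have "occurrences P = given P @ bases P @ concat (map consequents
      (take s (inferences P) @ inferences P ! s # drop (Suc s) (inferences P)))"
    unfolding occurrences_def by simp
  then have "occurrences P = ?L @ consequents (inferences P ! s)
      @ concat (map consequents (drop (Suc s) (inferences P)))"
    by simp
  moreover have "offset P s = length ?L" by (simp add: offset_def)
  ultimately obtain xs zs where "occurrences P = xs @ consequents (inferences P ! s) @ zs"
    "offset P s = length xs" by blast
  then show "offset P s + j < length (occurrences P)"
    "occurrences P ! (offset P s + j) = consequents (inferences P ! s) ! j"
    using assms(2) by (simp_all add: nth_append)
qed

lemma node_clause_node_at [simp]: "node_clause P (node_at P k) = occurrences P ! k"
  by (simp add: node_at_def)

text \<open>Here \<open>K\<close> will be a set of positions around an inference, \<open>h\<close>
  their clauses and \<open>g\<close> their nodes. If at most one position carries \<open>c\<close>,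
  at most one node is counted.\<close>

lemma card_image_fibre:
  assumes "\<And>k k'. k \<in> K \<Longrightarrow> k' \<in> K \<Longrightarrow> h k = c \<Longrightarrow> h k' = c \<Longrightarrow> k = k'"
  shows "card (g ` {k \<in> K. h k = c}) = of_bool (c \<in> h ` K)"
proof (cases "c \<in> h ` K")
  case True
  then obtain k where "k \<in> K" "h k = c" by auto
  then have "{k \<in> K. h k = c} = {k}" using assms by auto
  then show ?thesis using True by simp
next
  case False
  then have "{k \<in> K. h k = c} = {}" by auto
  then show ?thesis using False by (simp only: image_empty card.empty of_bool_eq)
qed

lemma finite_clause_nodes: "finite (clause_nodes P)"
  by (simp add: clause_nodes_def)

text \<open>Double counting: the sum over nodes becomes a sum over inferences, each weighted by the
  number of its neighbours in \<open>N\<close>.\<close>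

lemma sum_nbrs:
  assumes "finite N" "\<And>n. I n \<subseteq> inference_nodes P"
  shows "(\<Sum>n\<in>N. \<Sum>s\<in>I n. f s :: real) = (\<Sum>s<length (inferences P). f s * card {n \<in> N. s \<in> I n})"
proof -
  let ?S = "{..<length (inferences P)}"
  have "(\<Sum>s\<in>I n. f s) = (\<Sum>s\<in>?S. if s \<in> I n then f s else 0)" for n
    using assms(2)[of n] by (simp add: sum.If_cases inference_nodes_def Int_absorb1)
  then have "(\<Sum>n\<in>N. \<Sum>s\<in>I n. f s) = (\<Sum>s\<in>?S. \<Sum>n\<in>N. if s \<in> I n then f s else 0)"
    by (simp add: sum.swap[of _ N])
  also have "\<dots> = (\<Sum>s\<in>?S. f s * card {n \<in> N. s \<in> I n})"
    using assms(1) by (intro sum.cong) (auto simp: sum.If_cases Int_def)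
  finally show ?thesis .
qed

context
  fixes F :: "'v clause list" and P :: "'v preproof"
  assumes preproof: "circular_preproof F P"
begin

lemma antecedent_nth:
  assumes "s < length (inferences P)"
  shows "\<forall>i \<in> antecedents (inferences P ! s). i < length (occurrences P)"
    and "(!) (occurrences P) ` antecedents (inferences P ! s) = antecedent_clauses (inferences P ! s)"
    and "\<lbrakk>\<not> tautology C; i \<in> antecedents (inferences P ! s); j \<in> antecedents (inferences P ! s);
      occurrences P ! i = C; occurrences P ! j = C\<rbrakk> \<Longrightarrow> i = j"
proof -
  have correct: "correct_inference (take (offset P s) (occurrences P)) (inferences P ! s)"
    using preproof assms by (auto simp: circular_preproof_def)
  then show "\<forall>i \<in> antecedents (inferences P ! s). i < length (occurrences P)"
    by (cases "inferences P ! s") auto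
  show "(!) (occurrences P) ` antecedents (inferences P ! s) = antecedent_clauses (inferences P ! s)"
    using correct by (cases "inferences P ! s") (simp_all, metis nth_take)
  assume C: "\<not> tautology C" "i \<in> antecedents (inferences P ! s)" "j \<in> antecedents (inferences P ! s)"
    "occurrences P ! i = C" "occurrences P ! j = C"
  show "i = j"
  proof (cases "inferences P ! s")
    case (SymRes x k l B)
    then have "occurrences P ! k = finsert (Pos x) B" "occurrences P ! l = finsert (Neg x) B"
      using correct by (simp_all, (metis nth_take)+)
    \<comment> \<open>A clause equal to both antecedents would contain \<open>Pos x\<close> and
      \<open>Neg x\<close>.\<close>
    then have "occurrences P ! k \<noteq> C \<or> occurrences P ! l \<noteq> C"
      using C(1) by (auto simp: tautology_finsert finsert_Pos_eq_Neg)
    then show ?thesis using C SymRes by auto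
  next
    case (Split x k B)
    then show ?thesis using C by simp
  qed
qed

lemma card_out_nodes:
  assumes "s < length (inferences P)" "\<not> tautology C"
  shows "card {n \<in> clause_nodes P. node_clause P n = C \<and> s \<in> out_nbrs P n}
    = of_bool (C \<in> antecedent_clauses (inferences P ! s))"
proof -
  have "{n \<in> clause_nodes P. node_clause P n = C \<and> s \<in> out_nbrs P n}
    = node_at P ` {k \<in> antecedents (inferences P ! s). occurrences P ! k = C}"
    using assms(1) antecedent_nth(1)[OF assms(1)]
    by (auto simp: clause_nodes_def out_nbrs_def inference_nodes_def graph_arcs_def)
  also have "card \<dots> = of_bool (C \<in> (!) (occurrences P) ` antecedents (inferences P ! s))"
    using antecedent_nth(3)[OF assms] by (intro card_image_fibre)
  finally show ?thesis using antecedent_nth(2)[OF assms(1)] by simp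
qed

lemma card_in_nodes:
  assumes "s < length (inferences P)" "\<not> tautology C"
  shows "card {n \<in> clause_nodes P. node_clause P n = C \<and> s \<in> in_nbrs P n}
    = of_bool (C \<in> set (consequents (inferences P ! s)))"
proof -
  let ?cs = "consequents (inferences P ! s)"
  have eq: "{n \<in> clause_nodes P. node_clause P n = C \<and> s \<in> in_nbrs P n}
    = (\<lambda>j. node_at P (offset P s + j)) ` {j \<in> {..<length ?cs}. ?cs ! j = C}" (is "?L = ?R")
  proof
    show "?L \<subseteq> ?R"
    proof
      fix n assume "n \<in> ?L"
      then obtain k where k: "n = node_at P k" "offset P s \<le> k" "k < offset P s + length ?cs"
        "node_clause P n = C"
        by (auto simp: in_nbrs_def graph_arcs_def)
      define j where "j = k - offset P s"
      have "k = offset P s + j" "j < length ?cs" using k by (auto simp: j_def)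
      then show "n \<in> ?R" using k nth_occurrences[OF assms(1), of j] by auto
    qed
    show "?R \<subseteq> ?L"
    proof
      fix n assume "n \<in> ?R"
      then obtain j where j: "n = node_at P (offset P s + j)" "j < length ?cs" "?cs ! j = C"
        by auto
      then have "s \<in> in_nbrs P n"
        using assms(1) unfolding in_nbrs_def graph_arcs_def inference_nodes_def by auto
      then show "n \<in> ?L"
        using j nth_occurrences[OF assms(1) j(2)] by (auto simp: clause_nodes_def)
    qed
  qed
  \<comment> \<open>The two consequents of a split coincide only if they are tautologies, so a
    clause \<open>C\<close> that is none sits at one local index at most.\<close>
  have "card ?R = of_bool (C \<in> (!) ?cs ` {..<length ?cs})"
    using assms(2)
    by (intro card_image_fibre, cases "inferences P ! s")
      (auto simp: less_Suc_eq tautology_finsert finsert_Pos_eq_Neg)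
  moreover have "(!) ?cs ` {..<length ?cs} = set ?cs"
    by (auto simp: in_set_conv_nth)
  ultimately show ?thesis using eq by simp
qed

text \<open>On both sides an inference \<open>s\<close> contributes \<open>f s\<close> times the
  indicator that it produces \<open>C\<close> minus the indicator that it consumes \<open>C\<close>.
  A clause outside \<open>bases\<close> may label several nodes, hence the sum.\<close>

lemma total_weight_eq_balance:
  assumes "\<not> tautology C"
  shows "total_weight (\<Sum>s<length (inferences P). weight_change (f s) (inferences P ! s)) C
    = (\<Sum>n | n \<in> clause_nodes P \<and> node_clause P n = C. balance P f n)"
proof -
  let ?N = "{n \<in> clause_nodes P. node_clause P n = C}"
  have N: "finite ?N" by (simp add: finite_clause_nodes)
  have "(\<Sum>n\<in>?N. balance P f n) = (\<Sum>n\<in>?N. \<Sum>s\<in>in_nbrs P n. f s) - (\<Sum>n\<in>?N. \<Sum>s\<in>out_nbrs P n. f s)"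
    by (simp add: balance_def sum_subtractf)
  also have "\<dots> = (\<Sum>s<length (inferences P). f s * card {n \<in> ?N. s \<in> in_nbrs P n})
      - (\<Sum>s<length (inferences P). f s * card {n \<in> ?N. s \<in> out_nbrs P n})"
    using sum_nbrs[OF N, of "in_nbrs P" P f] sum_nbrs[OF N, of "out_nbrs P" P f]
    by (auto simp: in_nbrs_def out_nbrs_def)
  also have "\<dots> = (\<Sum>s<length (inferences P). total_weight (weight_change (f s) (inferences P ! s)) C)"
    unfolding sum_subtractf[symmetric]
    using card_in_nodes[OF _ assms] card_out_nodes[OF _ assms]
    by (intro sum.cong) (simp_all add: total_weight_change[OF assms] right_diff_distrib conj_assoc)
  finally show ?thesis by (simp add: total_weight_sum)
qed

end

section \<open>From the flow to the MaxSAT proof\<close>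

lemma balance_scale: "balance P (\<lambda>s. c * f s) n = c * balance P f n"
  by (simp add: balance_def sum_distrib_left right_diff_distrib)

lemma circular_proof_unit_flow:
  assumes "circular_proof F P A"
  obtains f where "\<forall>s\<in>inference_nodes P. f s > 0"
    "\<forall>n\<in>clause_nodes P. node_clause P n \<notin> set F \<longrightarrow> balance P f n \<ge> 0"
    "\<exists>n\<in>clause_nodes P. node_clause P n = A \<and> balance P f n = 1"
proof -
  obtain f n where f: "\<forall>s\<in>inference_nodes P. f s > 0"
    "\<forall>n\<in>clause_nodes P. node_clause P n \<notin> set F \<longrightarrow> balance P f n \<ge> 0"
    "n \<in> clause_nodes P" "node_clause P n = A" "balance P f n > 0"
    using assms unfolding circular_proof_def by blast
  show ?thesis
    \<comment> \<open>Dividing by a positive balance preserves all signs and makes that balance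
      1.\<close>
    by (rule that[of "\<lambda>s. (1 / balance P f n) * f s"]; (unfold balance_scale)?)
      (use f in \<open>auto intro!: bexI[of _ n]\<close>)
qed

text \<open>The indicator reserves one unit of \<open>A\<close>, which pays later for the copy taken
  away; all other clauses outside \<open>F\<close> just have to be non-negative.\<close>

lemma circular_proof_total_weight:
  assumes preproof: "circular_preproof F P"
    and nonneg: "\<forall>n\<in>clause_nodes P. node_clause P n \<notin> set F \<longrightarrow> balance P f n \<ge> 0"
    and unit: "\<exists>n\<in>clause_nodes P. node_clause P n = A \<and> balance P f n = 1"
    and taut: "\<not> tautology A" and C: "C \<notin> set F"
  shows "of_bool (C = A) \<le>
    total_weight (\<Sum>s<length (inferences P). weight_change (f s) (inferences P ! s)) C"
proof (cases "tautology C")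
  case True
  then show ?thesis
    using taut by (auto simp: total_weight_sum total_weight_change_tautology)
next
  case False
  let ?N = "{n \<in> clause_nodes P. node_clause P n = C}"
  have N: "finite ?N" "\<And>n. n \<in> ?N \<Longrightarrow> 0 \<le> balance P f n"
    using finite_clause_nodes[of P] nonneg C by auto
  have "of_bool (C = A) \<le> (\<Sum>n\<in>?N. balance P f n)"
  proof (cases "C = A")
    case True
    then obtain n where "n \<in> ?N" "balance P f n = 1" using unit by auto
    then show ?thesis using member_le_sum[of n ?N "balance P f"] N True by auto
  qed (use N in \<open>auto intro: sum_nonneg\<close>)
  then show ?thesis using total_weight_eq_balance[OF preproof False] by simp
qed

lemma ressv_proof_of_circular_proof:
  assumes "circular_proof F P A"
  shows "\<exists>Ms. ressv_proof (weighted \<infinity> F + neg_units A) {#({||}, 1)#} Ms \<and>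
    proof_length Ms \<le> 3 * graph_size P + fcard A"
proof (cases "tautology A")
  case True
  then obtain N where N: "ressv_step (neg_units A) (add_mset ({||}, 1) N)" "\<forall>(C, w)\<in>#N. 0 < w"
    using resolve_neg_units_tautology by blast
  have "(ressv_step ^^ 1) (weighted \<infinity> F + neg_units A) (weighted \<infinity> F + add_mset ({||}, 1) N)"
    unfolding relpowp_1 by (rule ressv_step_add[OF N(1)])
  moreover have "contained {#({||}, 1)#} (weighted \<infinity> F + add_mset ({||}, 1) N)"
    by (auto simp: contained_def)
  moreover have "\<forall>(C, w)\<in>#weighted \<infinity> F + add_mset ({||}, 1) N. 0 < w"
    using N(2) by (auto simp: weighted_def)
  ultimately obtain Ms where "ressv_proof (weighted \<infinity> F + neg_units A) {#({||}, 1)#} Ms"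
    "proof_length Ms = 1"
    using ressv_steps_proof by blast
  \<comment> \<open>A tautology has literals, so the single step is covered by
    \<open>fcard A\<close>.\<close>
  moreover have "fcard A \<noteq> 0" using True by (auto simp: tautology_def)
  ultimately show ?thesis by fastforce
next
  case False
  let ?W = "weighted \<infinity> F" and ?r = "length (inferences P)"
  have preproof: "circular_preproof F P" using assms by (simp add: circular_proof_def)
  obtain f where f: "\<forall>s\<in>inference_nodes P. f s > 0"
    "\<forall>n\<in>clause_nodes P. node_clause P n \<notin> set F \<longrightarrow> balance P f n \<ge> 0"
    "\<exists>n\<in>clause_nodes P. node_clause P n = A \<and> balance P f n = 1"
    using circular_proof_unit_flow[OF assms] .
  define D where "D = (\<Sum>s<?r. weight_change (f s) (inferences P ! s))"
  \<comment> \<open>The entry \<open>(A, - 1)\<close> is the debt from the virtual copy of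
    \<open>A\<close>. Its positive partner is kept apart for the resolutions with the negated
    units.\<close>
  let ?D = "add_mset (A, - 1) D"
  have "C \<in> set F \<or> 0 \<le> total_weight ?D C" for C
    using circular_proof_total_weight[OF preproof f(2,3) False, of C]
    by (cases "C = A") (auto simp: D_def[symmetric])
  then obtain N where N: "regroup\<^sup>*\<^sup>* (?W + finite_weights ?D) (?W + N)" "\<forall>(C, w)\<in>#N. 0 < w"
    using regroups_positive by blast
  let ?M = "?W + neg_units A"
  let ?V = "?M + {#(A, ereal 1), (A, ereal (- 1))#}"
  obtain k where k: "k \<le> 3 * ?r" "(ressv_step ^^ k) ?V (?V + finite_weights D)"
    using simulate_inferences[of ?r f ?V "inferences P"] f(1)
    by (auto simp: inference_nodes_def D_def)
  have "(ressv_step ^^ Suc k) ?M (?V + finite_weights D)"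
    using virtual_step k(2) by (rule relpowp_Suc_I2)
  \<comment> \<open>All debts are settled here at no cost; the regrouping belongs to the end of the
    last step so far.\<close>
  moreover have "regroup\<^sup>*\<^sup>* (?V + finite_weights D) (?W + N + add_mset (A, 1) (neg_units A))"
    using regroups_add[OF N(1), of "add_mset (A, 1) (neg_units A)"]
    by (simp add: add_ac one_ereal_def add_mset_commute)
  ultimately have 1: "(ressv_step ^^ Suc k) ?M (?W + N + add_mset (A, 1) (neg_units A))"
    by (rule ressv_steps_regroup)
  obtain N' where N': "(ressv_step ^^ fcard A) (add_mset (A, 1) (neg_units A)) (add_mset ({||}, 1) N')"
    "\<forall>(C, w)\<in>#N'. 0 < w"
    using resolve_neg_units[OF False] by blast
  have "(ressv_step ^^ (Suc k + fcard A)) ?M (?W + N + add_mset ({||}, 1) N')"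
    using ressv_steps_trans[OF 1 ressv_steps_add[OF N'(1)]] .
  moreover have "contained {#({||}, 1)#} (?W + N + add_mset ({||}, 1) N')"
    by (auto simp: contained_def)
  moreover have "\<forall>(C, w)\<in>#?W + N + add_mset ({||}, 1) N'. 0 < w"
    using N(2) N'(2) by (auto simp: weighted_def)
  ultimately obtain Ms where Ms: "ressv_proof ?M {#({||}, 1)#} Ms"
    "proof_length Ms = Suc k + fcard A"
    using ressv_steps_proof by blast
  \<comment> \<open>The extra virtual step for \<open>A\<close> is charged to a clause node, of
    which there is at least one.\<close>
  have "card (clause_nodes P) \<noteq> 0"
    using f(3) finite_clause_nodes[of P] by auto
  then have "Suc k \<le> 3 * graph_size P"
    using k(1) by (simp add: graph_size_def inference_nodes_def)
  then show ?thesis using Ms by auto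
qed

theorem theorem14:
  "\<exists>c::nat. \<forall>(F :: 'v clause list) (A :: 'v clause) (P :: 'v preproof).
     circular_proof F P A \<longrightarrow>
     (\<exists>Ms. ressv_proof (weighted \<infinity> F + neg_units A) {#({||}, 1)#} Ms \<and>
           proof_length Ms \<le> c * graph_size P + fcard A)"
  using ressv_proof_of_circular_proof by blast

end
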